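(* The Okubic affine plane $\mathscr{A}_2(\mathcal{O})$ satisfies the axioms of affine geometry: (i) any two distinct points are joined by a single line; (ii) any two non-parallel lines intersect in exactly one point; (iii) for each line and each point there is a unique line which passes through the point and is parallel to the given line.
   Context: The real Okubo algebra $\mathcal{O}$ is the 8-dimensional real vector space of $3\times 3$ complex Hermitian traceless matrices with bilinear product $x*y=\mu\,xy+\overline{\mu}\,yx-\frac13\mathrm{Tr}(xy)\,I$, where $\mu=\frac16(3+\mathrm{i}\sqrt3)$ and juxtaposition is the matrix product. The Okubic affine plane $\mathscr{A}_2(\mathcal{O})$ has as points the pairs $(x,y)$ with $x,y\in\mathcal{O}$. Its lines are the sets $[s,t]=\{(x,s*x+t):x\in\mathcal{O}\}$ for $s,t\in\mathcal{O}$ (slope $s$, offset $t$) and the vertical lines $[c]=\{c\}\times\mathcal{O}$ for $c\in\mathcal{O}$. A point is incident to a line if it belongs to it. Two lines are parallel if they are equal or disjoint (equivalently, both have the same slope $s$, or both are vertical). *)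

theory Defs
  imports "HOL-Analysis.Analysis"
begin

definition hermitian :: "complex^'n^'n \<Rightarrow> bool" where
  "hermitian A \<longleftrightarrow> (\<chi> i j. cnj (A $ j $ i)) = A"

(* complex scalar multiple of a matrix; the library's scaleR only covers real scalars *)
definition cscale :: "complex \<Rightarrow> complex^'n^'m \<Rightarrow> complex^'n^'m" where
  "cscale c A = (\<chi> i j. c * A $ i $ j)"

definition okubo :: "(complex^3^3) set" where
  "okubo = {A. hermitian A \<and> trace A = 0}"

definition okubo_mu :: complex where
  "okubo_mu = (3 + \<i> * complex_of_real (sqrt 3)) / 6"

definition okubo_mult :: "complex^3^3 \<Rightarrow> complex^3^3 \<Rightarrow> complex^3^3"  (infixl "\<star>" 70) where
  "x \<star> y = cscale okubo_mu (x ** y) + cscale (cnj okubo_mu) (y ** x)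
            - cscale (1/3 * trace (x ** y)) (mat 1)"

type_synonym okubo_point = "(complex^3^3) \<times> (complex^3^3)"

definition okubo_points :: "okubo_point set" where
  "okubo_points = okubo \<times> okubo"

definition sloped_line :: "complex^3^3 \<Rightarrow> complex^3^3 \<Rightarrow> okubo_point set" where
  "sloped_line s t = {(x, s \<star> x + t) | x. x \<in> okubo}"

definition vertical_line :: "complex^3^3 \<Rightarrow> okubo_point set" where
  "vertical_line c = {c} \<times> okubo"

definition okubo_lines :: "okubo_point set set" where
  "okubo_lines = {sloped_line s t | s t. s \<in> okubo \<and> t \<in> okubo} \<union> {vertical_line c | c. c \<in> okubo}"

(* a relation between lines, i.e. to be used only for elements of okubo_lines *)
definition parallel :: "okubo_point set \<Rightarrow> okubo_point set \<Rightarrow> bool"  (infix "\<parallel>" 50) where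
  "L \<parallel> M \<longleftrightarrow> L = M \<or> L \<inter> M = {}"

lemma hermitian_iff: "hermitian A \<longleftrightarrow> (\<forall>i j. cnj (A $ j $ i) = A $ i $ j)"
  by (simp add: hermitian_def vec_eq_iff)

lemma subspace_okubo: "subspace okubo"
  by (auto simp: subspace_def okubo_def hermitian_iff trace_def sum.distrib
      simp flip: scaleR_sum_right)

lemma okubo_mult_closed:
  assumes "x \<in> okubo" "y \<in> okubo"
  shows "x \<star> y \<in> okubo"
proof -
  have h: "cnj (x $ i $ j) = x $ j $ i" "cnj (y $ i $ j) = y $ j $ i" for i j
    using assms by (auto simp: okubo_def hermitian_iff)
  have m: "cnj ((x ** y) $ i $ j) = (y ** x) $ j $ i" "cnj ((y ** x) $ i $ j) = (x ** y) $ j $ i" for i j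
    by (simp_all add: matrix_matrix_mult_def h mult.commute)
  have c: "trace (y ** x) = trace (x ** y)"
    by (rule trace_mul_sym)
  have t: "cnj (trace (x ** y)) = trace (x ** y)"
    by (subst (2) c[symmetric]) (simp add: trace_def m)
  have s: "trace (cscale a A) = a * trace A" for a and A :: "complex^3^3"
    by (simp add: trace_def cscale_def sum_distrib_left)
  have "hermitian (x \<star> y)"
    by (simp add: hermitian_iff okubo_mult_def cscale_def m t mat_def)
  moreover have "okubo_mu + cnj okubo_mu = 1"
    by (simp add: okubo_mu_def complex_eq_iff)
  then have "trace (x \<star> y) = 0"
    by (simp add: okubo_mult_def trace_add trace_sub s c trace_I flip: distrib_right)
  ultimately show ?thesis
    by (simp add: okubo_def)
qed

lemma okubo_lines_subset: "L \<in> okubo_lines \<Longrightarrow> L \<subseteq> okubo_points"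
  by (auto simp: okubo_lines_def sloped_line_def vertical_line_def okubo_points_def
      intro: okubo_mult_closed subspace_add[OF subspace_okubo])

end

theory Submission
  imports Defs
begin

text \<open>
  The affine axioms for a plane coordinatised by a nonassociative algebra come down to unique
  division: two points with different abscissae are joined by a unique sloped line exactly when
  \<open>s \<star> a = b\<close> with \<open>a \<noteq> 0\<close> determines \<open>s\<close>, and two lines of different slopes meet in a unique
  point exactly when \<open>a \<star> x = b\<close> with \<open>a \<noteq> 0\<close> determines \<open>x\<close>. The Okubo algebra has no unit and
  is not even alternative, so division does not come from inverses. It comes from the identities
  of a symmetric composition algebra, \<open>(x \<star> y) \<star> x = n(x) y = x \<star> (y \<star> x)\<close>
  (\<open>okubo_composition\<close>), where \<open>n(x) = Tr(x\<^sup>2)/6\<close>: they say that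
  left and right multiplication by \<open>x\<close> are mutually inverse up to the factor \<open>n(x)\<close>. Since \<open>x\<close> is
  Hermitian, \<open>Tr(x\<^sup>2)\<close> is the squared Frobenius norm of \<open>x\<close>, hence nonzero when \<open>x \<noteq> 0\<close>. Thus
  \<open>a \<star> x = b\<close> has the single solution \<open>x = (b \<star> a)/n(a)\<close>, and \<open>x \<star> a = b\<close> the single solution
  \<open>x = (a \<star> b)/n(a)\<close>.

  The two identities hold because \<open>\<mu> + cnj \<mu> = 1\<close> and \<open>\<mu> * cnj \<mu> = 1/3\<close>, so that also
  \<open>\<mu>\<^sup>2 + (cnj \<mu>)\<^sup>2 = 1/3\<close>. Expanding \<open>(x \<star> y) \<star> x\<close> therefore gives \<open>xyx\<close>, \<open>x\<^sup>2 y\<close> and \<open>y x\<^sup>2\<close> the same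
  coefficient \<open>1/3\<close>, and the sum of these three products is what the polarised Cayley--Hamilton
  theorem for traceless matrices (\<open>polarised_cayley_hamilton_traceless\<close>) evaluates.

  For the parallel axiom, lines of different slopes, and a sloped and a vertical line, meet in exactly
  one point; as every line has at least two points, such lines are neither disjoint nor equal. Hence
  parallel lines are those of equal direction, and a point and a direction determine a line.
\<close>

section \<open>The symmetric composition identities\<close>

text \<open>
  A traceless 3-by-3 matrix satisfies \<open>x\<^sup>3 = Tr(x\<^sup>2)/2 x + det x\<close> by the Cayley--Hamilton theorem. The
  identity below is the part of this equation that is quadratic in \<open>x\<close> and linear in \<open>y\<close> after
  replacing \<open>x\<close> by \<open>x + y\<close>. In coordinates it is a polynomial identity in the entries once the
  last diagonal entries are eliminated.
\<close>
lemma polarised_cayley_hamilton_traceless: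
  fixes x y :: "complex^3^3"
  assumes "trace x = 0" "trace y = 0"
  shows "x ** y ** x + x ** x ** y + y ** x ** x
       = cscale (trace (x ** x) / 2) y + cscale (trace (x ** y)) x
         + cscale (trace (x ** x ** y)) (mat 1)"
proof -
  have x3: "x $ 3 $ 3 = - x $ 1 $ 1 - x $ 2 $ 2" and y3: "y $ 3 $ 3 = - y $ 1 $ 1 - y $ 2 $ 2"
    using assms by (simp_all add: trace_def sum_3 eq_neg_iff_add_eq_0 algebra_simps)
  show ?thesis
    by (simp add: vec_eq_iff forall_3 sum_3 matrix_matrix_mult_def trace_def cscale_def mat_def x3 y3)
       (simp add: field_simps)
qed

lemma okubo_mu_add_cnj: "okubo_mu + cnj okubo_mu = 1"
  by (simp add: okubo_mu_def complex_eq_iff)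

lemma okubo_mu_mult_cnj: "okubo_mu * cnj okubo_mu = 1/3"
  by (simp add: okubo_mu_def complex_eq_iff)

lemma matrix_mult_add_diff:
  fixes A :: "'a::ring_1^'n^'m"
  shows "A ** (B + C) = A ** B + A ** C" "A ** (B - C) = A ** B - A ** C"
    and "(A + A') ** B = A ** B + A' ** B" "(A - A') ** B = A ** B - A' ** B"
  by (simp_all add: matrix_matrix_mult_def vec_eq_iff algebra_simps sum.distrib sum_subtractf)

lemma cscale_matrix_mult:
  "cscale c A ** B = cscale c (A ** B)" "A ** cscale c B = cscale c (A ** B)"
  by (simp_all add: cscale_def matrix_matrix_mult_def vec_eq_iff sum_distrib_left ac_simps)

lemma cscale_of_real: "cscale (complex_of_real r) A = r *\<^sub>R A"
  by (simp add: cscale_def vec_eq_iff scaleR_conv_of_real[where 'a = complex])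

lemma trace_cscale: "trace (cscale c A) = c * trace A"
  by (simp add: trace_def cscale_def sum_distrib_left)

text \<open>
  Both products expand to the same sum \<open>?S\<close>: reversing the order of the factors exchanges \<open>\<mu>\<close> and its
  conjugate, and \<open>?S\<close> is symmetric in the two. The values \<open>1\<close> and \<open>1/3\<close> of their sum and
  product then give the three cubic terms equal weight, so that the Cayley--Hamilton identity applies.
\<close>
lemma okubo_mult_traceless_sandwich:
  assumes "trace x = 0" "trace y = 0"
  shows "(x \<star> y) \<star> x = cscale (trace (x ** x) / 6) y"
    and "x \<star> (y \<star> x) = cscale (trace (x ** x) / 6) y"
proof -
  let ?m = "okubo_mu" and ?n = "cnj okubo_mu"
  let ?S = "cscale (?m\<^sup>2 + ?n\<^sup>2) (x ** y ** x) + cscale (?m * ?n) (x ** x ** y + y ** x ** x)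
      - cscale ((?m + ?n) * trace (x ** y) / 3) x
      - cscale ((?m + ?n) * trace (x ** x ** y) / 3) (mat 1)"
  have traces: "trace (y ** x) = trace (x ** y)" "trace (x ** y ** x) = trace (x ** x ** y)"
      "trace (y ** x ** x) = trace (x ** x ** y)"
    by (metis matrix_mul_assoc trace_mul_sym)+
  note expand = okubo_mult_def matrix_mult_add_diff cscale_matrix_mult trace_add trace_sub
    trace_cscale matrix_mul_assoc traces assms
  have left: "(x \<star> y) \<star> x = ?S"
    by (simp add: expand) (simp add: vec_eq_iff cscale_def algebra_simps power2_eq_square
        add_divide_distrib)
  have right: "x \<star> (y \<star> x) = ?S"
    by (simp add: expand) (simp add: vec_eq_iff cscale_def algebra_simps power2_eq_square
        add_divide_distrib)
  have "?m\<^sup>2 + ?n\<^sup>2 = (?m + ?n)\<^sup>2 - 2 * (?m * ?n)"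
    by (simp add: power2_eq_square algebra_simps)
  then have squares: "?m\<^sup>2 + ?n\<^sup>2 = 1/3"
    by (simp add: okubo_mu_add_cnj okubo_mu_mult_cnj)
  have "?S = cscale (1/3) (x ** y ** x + x ** x ** y + y ** x ** x
      - cscale (trace (x ** y)) x - cscale (trace (x ** x ** y)) (mat 1))"
    unfolding squares okubo_mu_add_cnj okubo_mu_mult_cnj
    by (simp add: vec_eq_iff cscale_def algebra_simps)
  also have "\<dots> = cscale (trace (x ** x) / 6) y"
    unfolding polarised_cayley_hamilton_traceless[OF assms] by (simp add: vec_eq_iff cscale_def)
  finally show "(x \<star> y) \<star> x = cscale (trace (x ** x) / 6) y"
      "x \<star> (y \<star> x) = cscale (trace (x ** x) / 6) y"
    by (simp_all only: left right)
qed

lemma trace_square_hermitian: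
  fixes x :: "complex^'n^'n"
  assumes "hermitian x"
  shows "trace (x ** x) = complex_of_real ((norm x)\<^sup>2)"
proof -
  have "x $ i $ j * x $ j $ i = complex_of_real (x $ i $ j \<bullet> x $ i $ j)" for i j
    using assms[unfolded hermitian_iff, rule_format, of i j]
    by (metis complex_norm_square power2_norm_eq_inner)
  then show ?thesis
    by (simp add: trace_def matrix_matrix_mult_def power2_norm_eq_inner inner_vec_def)
qed

text \<open>
  Over the Hermitian matrices the scalar \<open>Tr(x\<^sup>2)/6\<close> is a positive multiple of the squared norm, which
  makes the identities invertible for \<open>x \<noteq> 0\<close>.
\<close>
lemma okubo_composition:
  assumes "x \<in> okubo" "y \<in> okubo"
  shows "(x \<star> y) \<star> x = ((norm x)\<^sup>2 / 6) *\<^sub>R y" and "x \<star> (y \<star> x) = ((norm x)\<^sup>2 / 6) *\<^sub>R y"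
proof -
  have "trace (x ** x) / 6 = complex_of_real ((norm x)\<^sup>2 / 6)"
    using assms by (simp add: okubo_def trace_square_hermitian)
  then show "(x \<star> y) \<star> x = ((norm x)\<^sup>2 / 6) *\<^sub>R y" "x \<star> (y \<star> x) = ((norm x)\<^sup>2 / 6) *\<^sub>R y"
    using assms okubo_mult_traceless_sandwich[of x y]
    by (simp_all only: okubo_def mem_Collect_eq cscale_of_real)
qed

section \<open>Division in the Okubo algebra\<close>

lemma cscale_diff:
  "cscale c (A - B) = cscale c A - cscale c B"
  "cscale (c - d) A = cscale c A - cscale d A"
  by (simp_all add: cscale_def vec_eq_iff algebra_simps)

lemma okubo_mult_diff_left: "(x - y) \<star> z = x \<star> z - y \<star> z"
  by (simp add: okubo_mult_def matrix_mult_add_diff trace_sub diff_divide_distrib cscale_diff)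

lemma okubo_mult_diff_right: "z \<star> (x - y) = z \<star> x - z \<star> y"
  by (simp add: okubo_mult_def matrix_mult_add_diff trace_sub diff_divide_distrib cscale_diff)

lemma okubo_mult_scaleR:
  "(r *\<^sub>R x) \<star> y = r *\<^sub>R (x \<star> y)"
  "x \<star> (r *\<^sub>R y) = r *\<^sub>R (x \<star> y)"
  unfolding okubo_mult_def cscale_of_real[symmetric] cscale_matrix_mult trace_cscale
  by (simp_all add: cscale_def vec_eq_iff algebra_simps)

lemma okubo_diff_closed: "x \<in> okubo \<Longrightarrow> y \<in> okubo \<Longrightarrow> x - y \<in> okubo"
  by (rule subspace_diff[OF subspace_okubo])

text \<open>
  In both division lemmas the composition identities are used twice: one gives a solution, the other
  recovers any solution \<open>x\<close> from \<open>b\<close> by multiplying the equation with \<open>a\<close> on the opposite side.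
\<close>
lemma okubo_left_division:
  assumes "a \<in> okubo" "b \<in> okubo" "a \<noteq> 0"
  shows "\<exists>!x. x \<in> okubo \<and> a \<star> x = b"
proof
  show "(6 / (norm a)\<^sup>2) *\<^sub>R (b \<star> a) \<in> okubo \<and> a \<star> ((6 / (norm a)\<^sup>2) *\<^sub>R (b \<star> a)) = b"
    using assms
    by (simp add: okubo_mult_closed subspace_scale[OF subspace_okubo] okubo_mult_scaleR
        okubo_composition(2))
next
  fix x assume x: "x \<in> okubo \<and> a \<star> x = b"
  have "b \<star> a = ((norm a)\<^sup>2 / 6) *\<^sub>R x"
    using okubo_composition(1)[of a x] assms x by simp
  then show "x = (6 / (norm a)\<^sup>2) *\<^sub>R (b \<star> a)"
    using assms by simp
qed

lemma okubo_right_division: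
  assumes "a \<in> okubo" "b \<in> okubo" "a \<noteq> 0"
  shows "\<exists>!x. x \<in> okubo \<and> x \<star> a = b"
proof
  show "(6 / (norm a)\<^sup>2) *\<^sub>R (a \<star> b) \<in> okubo \<and> ((6 / (norm a)\<^sup>2) *\<^sub>R (a \<star> b)) \<star> a = b"
    using assms
    by (simp add: okubo_mult_closed subspace_scale[OF subspace_okubo] okubo_mult_scaleR
        okubo_composition(1))
next
  fix x assume x: "x \<in> okubo \<and> x \<star> a = b"
  have "a \<star> b = ((norm a)\<^sup>2 / 6) *\<^sub>R x"
    using okubo_composition(2)[of a x] assms x by simp
  then show "x = (6 / (norm a)\<^sup>2) *\<^sub>R (a \<star> b)"
    using assms by simp
qed

section \<open>Lines of the Okubic plane\<close>

lemma mem_sloped_line: "(x, y) \<in> sloped_line s t \<longleftrightarrow> x \<in> okubo \<and> y = s \<star> x + t"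
  by (auto simp: sloped_line_def)

lemma mem_vertical_line: "(x, y) \<in> vertical_line c \<longleftrightarrow> x = c \<and> y \<in> okubo"
  by (auto simp: vertical_line_def)

lemma okubo_lines_cases:
  assumes "L \<in> okubo_lines"
  obtains (sloped) s t where "s \<in> okubo" "t \<in> okubo" "L = sloped_line s t"
    | (vertical) c where "c \<in> okubo" "L = vertical_line c"
  using assms by (auto simp: okubo_lines_def)

lemma okubo_nontrivial: "\<exists>x\<in>okubo. x \<noteq> 0"
proof -
  define d :: "complex^3^3"
    where "d = (\<chi> i j. if i = j then (if i = 1 then 1 else if i = 2 then -1 else 0) else 0)"
  have "d \<in> okubo"
    by (simp add: okubo_def hermitian_iff trace_def sum_3 d_def)
  moreover have "d $ 1 $ 1 = 1"
    by (simp add: d_def)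
  then have "d \<noteq> 0"
    by auto
  ultimately show ?thesis by blast
qed

text \<open>
  The abscissa of a common point solves \<open>(s - s') \<star> x = t' - t\<close>, an equation with nonzero left factor.
\<close>
lemma sloped_lines_meet:
  assumes "s \<in> okubo" "t \<in> okubo" "s' \<in> okubo" "t' \<in> okubo" "s \<noteq> s'"
  shows "\<exists>!p. p \<in> sloped_line s t \<and> p \<in> sloped_line s' t'"
proof -
  have meets: "(s - s') \<star> x = t' - t \<longleftrightarrow> s \<star> x + t = s' \<star> x + t'" for x
  proof -
    have "(s - s') \<star> x - (t' - t) = (s \<star> x + t) - (s' \<star> x + t')"
      by (simp add: okubo_mult_diff_left)
    then show ?thesis
      by (metis eq_iff_diff_eq_0)
  qed
  have "\<exists>!x. x \<in> okubo \<and> (s - s') \<star> x = t' - t"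
    using assms by (intro okubo_left_division okubo_diff_closed) simp_all
  then obtain x where x: "x \<in> okubo" "s \<star> x + t = s' \<star> x + t'"
    and uniq: "\<And>z. z \<in> okubo \<Longrightarrow> s \<star> z + t = s' \<star> z + t' \<Longrightarrow> z = x"
    unfolding meets by blast
  show ?thesis
  proof
    show "(x, s \<star> x + t) \<in> sloped_line s t \<and> (x, s \<star> x + t) \<in> sloped_line s' t'"
      using x by (simp add: mem_sloped_line)
  next
    fix p assume p: "p \<in> sloped_line s t \<and> p \<in> sloped_line s' t'"
    obtain z w where zw: "p = (z, w)"
      by (cases p)
    with p have z: "z \<in> okubo" "w = s \<star> z + t" "s \<star> z + t = s' \<star> z + t'"
      by (auto simp: mem_sloped_line)
    have "z = x"
      by (rule uniq[OF z(1,3)])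
    with zw z(2) show "p = (x, s \<star> x + t)"
      by simp
  qed
qed

lemma sloped_vertical_meet:
  assumes "s \<in> okubo" "t \<in> okubo" "c \<in> okubo"
  shows "\<exists>!p. p \<in> sloped_line s t \<and> p \<in> vertical_line c"
proof
  show "(c, s \<star> c + t) \<in> sloped_line s t \<and> (c, s \<star> c + t) \<in> vertical_line c"
    using assms by (simp add: mem_sloped_line mem_vertical_line okubo_mult_closed
        subspace_add[OF subspace_okubo])
next
  fix p assume "p \<in> sloped_line s t \<and> p \<in> vertical_line c"
  then show "p = (c, s \<star> c + t)"
    by (cases p) (simp add: mem_sloped_line mem_vertical_line)
qed

lemma okubo_line_two_points:
  assumes "L \<in> okubo_lines"
  shows "\<exists>p\<in>L. \<exists>q\<in>L. p \<noteq> q"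
proof -
  obtain d where d: "d \<in> okubo" "d \<noteq> 0"
    using okubo_nontrivial by blast
  have z: "0 \<in> okubo"
    by (rule subspace_0[OF subspace_okubo])
  from assms show ?thesis
  proof (cases rule: okubo_lines_cases)
    case (sloped s t)
    then have "(0, s \<star> 0 + t) \<in> L" "(d, s \<star> d + t) \<in> L"
      using d z by (simp_all add: mem_sloped_line)
    with d show ?thesis by blast
  next
    case (vertical c)
    then have "(c, 0) \<in> L" "(c, d) \<in> L"
      using d z by (simp_all add: mem_vertical_line)
    with d show ?thesis by blast
  qed
qed

text \<open>
  Meeting in a single point excludes equality as well as disjointness because no line is a single
  point; this is where the algebra has to be nonzero.
\<close>
lemma not_parallel_if_meet_once:
  assumes "L \<in> okubo_lines" "\<exists>!p. p \<in> L \<and> p \<in> M"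
  shows "\<not> L \<parallel> M"
proof
  assume "L \<parallel> M"
  with assms(2) have "L = M"
    unfolding parallel_def by blast
  with okubo_line_two_points[OF assms(1)] assms(2) show False
    by metis
qed

lemma sloped_line_in_lines: "s \<in> okubo \<Longrightarrow> t \<in> okubo \<Longrightarrow> sloped_line s t \<in> okubo_lines"
  by (auto simp: okubo_lines_def)

lemma vertical_line_in_lines: "c \<in> okubo \<Longrightarrow> vertical_line c \<in> okubo_lines"
  by (auto simp: okubo_lines_def)

lemma parallel_sym: "L \<parallel> M \<longleftrightarrow> M \<parallel> L"
  by (auto simp: parallel_def)

text \<open>
  Parallelism is equality of directions: this and the next two lemmas reduce the uniqueness of
  parallels to the fact that a line is determined by its direction and one of its points.
\<close>
lemma sloped_parallel_iff:
  assumes "s \<in> okubo" "t \<in> okubo" "s' \<in> okubo" "t' \<in> okubo"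
  shows "sloped_line s t \<parallel> sloped_line s' t' \<longleftrightarrow> s = s'"
proof
  show "s = s'" if "sloped_line s t \<parallel> sloped_line s' t'"
  proof (rule ccontr)
    assume "s \<noteq> s'"
    with assms have "\<exists>!p. p \<in> sloped_line s t \<and> p \<in> sloped_line s' t'"
      by (rule sloped_lines_meet)
    then show False
      using that not_parallel_if_meet_once[OF sloped_line_in_lines[OF assms(1,2)]] by simp
  qed
  show "s = s' \<Longrightarrow> sloped_line s t \<parallel> sloped_line s' t'"
    by (cases "t = t'") (auto simp: parallel_def mem_sloped_line)
qed

lemma sloped_vertical_not_parallel:
  assumes "s \<in> okubo" "t \<in> okubo" "c \<in> okubo"
  shows "\<not> sloped_line s t \<parallel> vertical_line c"
  by (rule not_parallel_if_meet_once[OF sloped_line_in_lines[OF assms(1,2)] sloped_vertical_meet[OF assms]])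

lemma vertical_parallel: "vertical_line c \<parallel> vertical_line c'"
  by (cases "c = c'") (auto simp: parallel_def mem_vertical_line)

section \<open>The affine axioms\<close>

text \<open>
  A sloped line takes one value at each abscissa, so only a vertical line joins two points with equal
  abscissae; otherwise right division by the difference of the abscissae yields the slope.
\<close>
lemma unique_joining_line:
  assumes p: "p \<in> okubo_points" and q: "q \<in> okubo_points" and "p \<noteq> q"
  shows "\<exists>!L. L \<in> okubo_lines \<and> p \<in> L \<and> q \<in> L"
proof -
  obtain x y x' y' where pq: "p = (x, y)" "q = (x', y')"
    and mem: "x \<in> okubo" "y \<in> okubo" "x' \<in> okubo" "y' \<in> okubo"
    using p q by (auto simp: okubo_points_def)
  show ?thesis
  proof (cases "x = x'")
    case True
    then have "y \<noteq> y'"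
      using \<open>p \<noteq> q\<close> pq by simp
    show ?thesis
    proof
      show "vertical_line x \<in> okubo_lines \<and> p \<in> vertical_line x \<and> q \<in> vertical_line x"
        using True pq mem by (simp add: vertical_line_in_lines mem_vertical_line)
    next
      fix L assume L: "L \<in> okubo_lines \<and> p \<in> L \<and> q \<in> L"
      then have "L \<in> okubo_lines" by simp
      then show "L = vertical_line x"
        by (cases rule: okubo_lines_cases)
           (use L True pq \<open>y \<noteq> y'\<close> in \<open>auto simp: mem_sloped_line mem_vertical_line\<close>)
    qed
  next
    case False
    have joins: "p \<in> sloped_line s t \<and> q \<in> sloped_line s t
        \<longleftrightarrow> s \<star> (x - x') = y - y' \<and> t = y - s \<star> x" for s t
      using pq mem by (auto simp: mem_sloped_line okubo_mult_diff_right algebra_simps)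
    have "\<exists>!s. s \<in> okubo \<and> s \<star> (x - x') = y - y'"
      using mem False by (intro okubo_right_division) (auto intro: okubo_diff_closed)
    then obtain s where s: "s \<in> okubo" "s \<star> (x - x') = y - y'"
      and uniq: "\<And>r. r \<in> okubo \<Longrightarrow> r \<star> (x - x') = y - y' \<Longrightarrow> r = s"
      by auto
    show ?thesis
    proof
      show "sloped_line s (y - s \<star> x) \<in> okubo_lines
          \<and> p \<in> sloped_line s (y - s \<star> x) \<and> q \<in> sloped_line s (y - s \<star> x)"
        using s mem joins
        by (simp add: sloped_line_in_lines okubo_diff_closed okubo_mult_closed)
    next
      fix L assume L: "L \<in> okubo_lines \<and> p \<in> L \<and> q \<in> L"
      then have "L \<in> okubo_lines" by simp
      then show "L = sloped_line s (y - s \<star> x)"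
      proof (cases rule: okubo_lines_cases)
        case (sloped r t)
        then have "r \<star> (x - x') = y - y'" "t = y - r \<star> x"
          using L joins[of r t] by simp_all
        then show ?thesis
          using sloped uniq[of r] by simp
      next
        case (vertical c)
        then show ?thesis using L pq False by (simp add: mem_vertical_line)
      qed
    qed
  qed
qed

lemma unique_intersection:
  assumes L: "L \<in> okubo_lines" and M: "M \<in> okubo_lines" and np: "\<not> L \<parallel> M"
  shows "\<exists>!p. p \<in> okubo_points \<and> p \<in> L \<and> p \<in> M"
proof -
  have "\<exists>!p. p \<in> L \<and> p \<in> M"
    using L
  proof (cases rule: okubo_lines_cases)
    case L: (sloped s t)
    from M show ?thesis
    proof (cases rule: okubo_lines_cases)
      case (sloped s' t')
      with L np have "s \<noteq> s'"
        by (auto simp: sloped_parallel_iff)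
      then show ?thesis
        unfolding L(3) sloped(3) by (rule sloped_lines_meet[OF L(1,2) sloped(1,2)])
    next
      case (vertical c)
      show ?thesis
        unfolding L(3) vertical(2) by (rule sloped_vertical_meet[OF L(1,2) vertical(1)])
    qed
  next
    case L: (vertical c)
    from M show ?thesis
    proof (cases rule: okubo_lines_cases)
      case (sloped s t)
      have "\<exists>!p. p \<in> M \<and> p \<in> L"
        unfolding L(2) sloped(3) by (rule sloped_vertical_meet[OF sloped(1,2) L(1)])
      then show ?thesis by (subst conj_commute)
    next
      case (vertical c')
      with L np show ?thesis by (simp add: vertical_parallel)
    qed
  qed
  moreover have "p \<in> okubo_points \<and> p \<in> L \<and> p \<in> M \<longleftrightarrow> p \<in> L \<and> p \<in> M" for p
    using okubo_lines_subset[OF L] by blast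
  ultimately show ?thesis
    by simp
qed

lemma unique_parallel:
  assumes L: "L \<in> okubo_lines" and p: "p \<in> okubo_points"
  shows "\<exists>!M. M \<in> okubo_lines \<and> p \<in> M \<and> M \<parallel> L"
proof -
  obtain x y where pxy: "p = (x, y)" and mem: "x \<in> okubo" "y \<in> okubo"
    using p by (auto simp: okubo_points_def)
  from L show ?thesis
  proof (cases rule: okubo_lines_cases)
    case L: (sloped s t)
    show ?thesis
    proof
      show "sloped_line s (y - s \<star> x) \<in> okubo_lines \<and> p \<in> sloped_line s (y - s \<star> x)
          \<and> sloped_line s (y - s \<star> x) \<parallel> L"
        using L mem pxy
        by (simp add: sloped_line_in_lines mem_sloped_line sloped_parallel_iff okubo_diff_closed
            okubo_mult_closed)
    next
      fix M assume M: "M \<in> okubo_lines \<and> p \<in> M \<and> M \<parallel> L"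
      then have "M \<in> okubo_lines" by simp
      then show "M = sloped_line s (y - s \<star> x)"
      proof (cases rule: okubo_lines_cases)
        case (sloped r u)
        then have "r = s"
          using M L by (simp add: sloped_parallel_iff)
        then show ?thesis
          using sloped M pxy by (simp add: mem_sloped_line)
      next
        case (vertical c)
        then have "\<not> L \<parallel> M"
          using L by (simp add: sloped_vertical_not_parallel)
        then show ?thesis
          using M by (simp add: parallel_sym[of M L])
      qed
    qed
  next
    case L: (vertical c)
    show ?thesis
    proof
      show "vertical_line x \<in> okubo_lines \<and> p \<in> vertical_line x \<and> vertical_line x \<parallel> L"
        using L mem pxy by (simp add: vertical_line_in_lines mem_vertical_line vertical_parallel)
    next
      fix M assume M: "M \<in> okubo_lines \<and> p \<in> M \<and> M \<parallel> L"
      then have "M \<in> okubo_lines" by simp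
      then show "M = vertical_line x"
      proof (cases rule: okubo_lines_cases)
        case (sloped r u)
        then show ?thesis
          using M L by (simp add: sloped_vertical_not_parallel)
      next
        case (vertical c')
        then show ?thesis
          using M pxy by (simp add: mem_vertical_line)
      qed
    qed
  qed
qed

theorem theorem5:
  shows "(\<forall>p \<in> okubo_points. \<forall>q \<in> okubo_points. p \<noteq> q \<longrightarrow>
            (\<exists>!L. L \<in> okubo_lines \<and> p \<in> L \<and> q \<in> L))
       \<and> (\<forall>L \<in> okubo_lines. \<forall>M \<in> okubo_lines. \<not> L \<parallel> M \<longrightarrow>
            (\<exists>!p. p \<in> okubo_points \<and> p \<in> L \<and> p \<in> M))
       \<and> (\<forall>L \<in> okubo_lines. \<forall>p \<in> okubo_points.
            (\<exists>!M. M \<in> okubo_lines \<and> p \<in> M \<and> M \<parallel> L))"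
  by (intro conjI ballI impI unique_joining_line unique_intersection unique_parallel)

end
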